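(* Let $n\ge 2$, $x=(x_1,\dots,x_n)\in\mathbb{H}^n$ and $r\in(0,\pi/2)$. Then $$B^n\big(x+(\sec^2 r-1)x_n e_n,\ (\tan r)x_n\big)\subset B_v(x,r)\subset B^n\left(x+(2x_n\tan^2 r)e_n,\ 2x_n\frac{\tan r}{\cos r}\right),$$ and these Euclidean balls are the best possible: no Euclidean ball of radius larger than $(\tan r)x_n$ is contained in $B_v(x,r)$, and no Euclidean ball of radius smaller than $2x_n\frac{\tan r}{\cos r}$ contains $B_v(x,r)$. Moreover, $$B^n(x,x_n\sin r)\subset B_v(x,r)\subset B^n\left(x,\ 2x_n\left(\frac{\tan r}{\cos r}+\tan^2 r\right)\right).$$
   Context: $\mathbb{H}^n=\{(x_1,\dots,x_n)\in\mathbb{R}^n: x_n>0\}$ is the upper half space, $e_n=(0,\dots,0,1)$, and $B^n(a,\rho)=\{y\in\mathbb{R}^n:|y-a|<\rho\}$ is the open Euclidean ball. The visual angle metric of $\mathbb{H}^n$ is $$v_{\mathbb{H}^n}(x,y)=\sup\{\measuredangle(x,z,y): z\in\partial\mathbb{H}^n\},$$ where $\partial\mathbb{H}^n=\{z\in\mathbb{R}^n:z_n=0\}$ and $\measuredangle(x,z,y)\in[0,\pi]$ is the angle at $z$ between the segments $[x,z]$ and $[y,z]$. The ball is $B_v(x,r)=\{y\in\mathbb{H}^n: v_{\mathbb{H}^n}(x,y)<r\}$. *)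

theory Defs
  imports "HOL-Analysis.Analysis"
begin

text \<open>
  The space R^n is \<open>real ^ 'n\<close> with \<open>n = CARD('n)\<close>. The index type is linearly ordered, so that
  it has a last index, which plays the role of the index n in x_n and e_n.
\<close>

definition last_index :: "'n::{finite,linorder}" where
  "last_index = Max UNIV"

abbreviation last_coord :: "real ^ 'n::{finite,linorder} \<Rightarrow> real" where
  "last_coord x \<equiv> x $ last_index"

abbreviation e_last :: "real ^ 'n::{finite,linorder}" where
  "e_last \<equiv> axis last_index 1"

definition upper_half_space :: "(real ^ 'n::{finite,linorder}) set" where
  "upper_half_space = {x. last_coord x > 0}"

definition half_space_boundary :: "(real ^ 'n::{finite,linorder}) set" where
  "half_space_boundary = {z. last_coord z = 0}"

lemma frontier_upper_half_space:
  "frontier (upper_half_space :: (real ^ 'n::{finite,linorder}) set) = half_space_boundary"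
proof -
  have "(upper_half_space :: (real ^ 'n::{finite,linorder}) set) = {x. e_last \<bullet> x > 0}"
    by (simp add: upper_half_space_def inner_axis')
  moreover have "(e_last :: real ^ 'n::{finite,linorder}) \<noteq> 0"
    by simp
  ultimately have "frontier (upper_half_space :: (real ^ 'n::{finite,linorder}) set)
      = {x. e_last \<bullet> x = 0}"
    using frontier_halfspace_gt[of "e_last :: real ^ 'n::{finite,linorder}" 0] by simp
  then show ?thesis
    by (simp add: half_space_boundary_def inner_axis')
qed

text \<open>
  The angle at \<open>z\<close> between the segments [x,z] and [y,z], a number in [0,pi]. It is meaningful for
  \<open>x \<noteq> z\<close> and \<open>y \<noteq> z\<close>, which is always the case when x, y lie in the upper half space and
  z lies on its boundary.
\<close>

definition angle_at :: "'a::real_inner \<Rightarrow> 'a \<Rightarrow> 'a \<Rightarrow> real" where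
  "angle_at x z y = arccos (((x - z) \<bullet> (y - z)) / (norm (x - z) * norm (y - z)))"

lemma angle_at_bounds: "angle_at x z y \<in> {0..pi}"
proof -
  have "\<bar>((x - z) \<bullet> (y - z)) / (norm (x - z) * norm (y - z))\<bar> \<le> 1"
    using Cauchy_Schwarz_ineq2[of "x - z" "y - z"] by (auto simp: abs_mult divide_le_eq_1)
  then show ?thesis
    unfolding angle_at_def by (auto simp only: abs_le_iff atLeastAtMost_iff
        intro!: arccos_lbound arccos_ubound)
qed

text \<open>
  The supremum is one of reals; the set of angles is nonempty and bounded by pi, so it is the
  genuine least upper bound.
\<close>

definition visual_angle_metric ::
    "real ^ 'n::{finite,linorder} \<Rightarrow> real ^ 'n::{finite,linorder} \<Rightarrow> real" where
  "visual_angle_metric x y = (SUP z\<in>half_space_boundary. angle_at x z y)"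

lemma visual_angle_set_nonempty_bdd:
  fixes x y :: "real ^ 'n::{finite,linorder}"
  shows "(\<lambda>z. angle_at x z y) ` half_space_boundary \<noteq> {}"
    and "bdd_above ((\<lambda>z. angle_at x z y) ` half_space_boundary)"
proof -
  have "(0 :: real ^ 'n::{finite,linorder}) \<in> half_space_boundary"
    by (simp add: half_space_boundary_def)
  then show "(\<lambda>z. angle_at x z y) ` half_space_boundary \<noteq> {}"
    by blast
  show "bdd_above ((\<lambda>z. angle_at x z y) ` half_space_boundary)"
    using angle_at_bounds by (intro bdd_aboveI2[where M = pi]) auto
qed

definition visual_ball ::
    "real ^ 'n::{finite,linorder} \<Rightarrow> real \<Rightarrow> (real ^ 'n::{finite,linorder}) set" where
  "visual_ball x r = {y \<in> upper_half_space. visual_angle_metric x y < r}"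

end

theory Submission
  imports Defs
begin

text \<open>
  Write \<open>h\<close> for the height of \<open>x\<close> and \<open>w = y - x\<close>, with horizontal part \<open>w'\<close> and vertical
  component \<open>w\<^sub>n\<close>. The condition \<open>v(x,y) < r\<close> says that \<open>y\<close> lies in the cone of half-angle \<open>r\<close> about
  the ray from \<open>z\<close> through \<open>x\<close> for every boundary point \<open>z\<close>. In a vertical plane through \<open>x\<close> the lines
  bounding these cones envelop two parabolas with focus \<open>x\<close>, and the visual ball is the region
  \<open>\<bar>w\<bar> + cos r \<bar>w'\<bar> - sin r w\<^sub>n < 2 h sin r\<close> inside both of them. All inclusions and their
  optimality are read off from this inequality: the region has vertical diameter \<open>4 h tan r / cos r\<close>
  and horizontal width \<open>2 h tan r\<close>.
\<close>

section \<open>The gauge function and lengths of horizontal parts\<close>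

text \<open>With \<open>p\<close> the length of the horizontal part and \<open>q\<close> the height
  of \<open>w\<close>, the level set at \<open>b > 0\<close> is
  \<open>norm w = b - (cos r * p - sin r * q)\<close>: the distance to the focus \<open>0\<close>
  equals the distance to the directrix \<open>cos r * p - sin r * q = b\<close>. Taking
  \<open>p \<ge> 0\<close> treats both mirror-image parabolas at once.\<close>

definition parabola_gauge :: "'a::real_inner \<Rightarrow> real \<Rightarrow> 'a \<Rightarrow> real" where
  "parabola_gauge E r w = norm w + cos r * norm (w - (w \<bullet> E) *\<^sub>R E) - sin r * (w \<bullet> E)"

lemma norm_horizontal_sq:
  fixes E w :: "'a::real_inner"
  assumes "norm E = 1"
  shows "(norm (w - (w \<bullet> E) *\<^sub>R E))\<^sup>2 = (norm w)\<^sup>2 - (w \<bullet> E)\<^sup>2"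
proof -
  have "E \<bullet> E = 1" using assms by (simp add: dot_square_norm)
  then show ?thesis
    unfolding power2_norm_eq_inner
    by (simp add: inner_diff_left inner_diff_right inner_commute power2_eq_square)
qed

lemma cos_combination_le_norm:
  fixes a b :: real
  shows "cos r * a + sin r * b \<le> sqrt (a\<^sup>2 + b\<^sup>2)"
proof (rule real_le_rsqrt)
  have "(cos r * a + sin r * b)\<^sup>2 + (sin r * a - cos r * b)\<^sup>2
      = ((sin r)\<^sup>2 + (cos r)\<^sup>2) * (a\<^sup>2 + b\<^sup>2)" by algebra
  then have "(cos r * a + sin r * b)\<^sup>2 + (sin r * a - cos r * b)\<^sup>2 = a\<^sup>2 + b\<^sup>2" by simp
  then show "(cos r * a + sin r * b)\<^sup>2 \<le> a\<^sup>2 + b\<^sup>2"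
    using zero_le_power2[of "sin r * a - cos r * b"] by linarith
qed

section \<open>Cones with apex on the boundary against the gauge\<close>

text \<open>This is the triangle inequality on the unit sphere for \<open>u\<close>,
  \<open>m\<close>, \<open>E\<close>. Removing the components along \<open>m\<close> from
  \<open>u\<close> and \<open>E\<close> leaves vectors of length \<open>cos r\<close> and of the
  length of the horizontal part of \<open>m\<close>; Cauchy-Schwarz for these remainders gives the
  bound.\<close>

lemma normal_height_bound:
  fixes E m u :: "'a::real_inner"
  assumes E: "norm E = 1" and m: "norm m = 1" and u: "norm u = 1"
    and mu: "m \<bullet> u = sin r" and c: "cos r \<ge> 0"
  shows "u \<bullet> E \<le> sin r * (m \<bullet> E) + cos r * norm (m - (m \<bullet> E) *\<^sub>R E)"
proof -
  have mm: "m \<bullet> m = 1" and uu: "u \<bullet> u = 1" and EE: "E \<bullet> E = 1"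
    using m u E by (simp_all add: dot_square_norm)
  define a where "a = u - sin r *\<^sub>R m"
  define b where "b = E - (m \<bullet> E) *\<^sub>R m"
  have "(norm a)\<^sup>2 = (cos r)\<^sup>2"
    unfolding a_def power2_norm_eq_inner
    by (simp add: inner_diff_left inner_diff_right inner_commute mm uu mu power2_eq_square
        cos_squared_eq[unfolded power2_eq_square] inner_commute[of u m])
  then have na: "norm a = cos r" using c by (simp add: power2_eq_iff_nonneg)
  have "(norm b)\<^sup>2 = 1 - (m \<bullet> E)\<^sup>2"
    unfolding b_def power2_norm_eq_inner
    by (simp add: inner_diff_left inner_diff_right mm EE power2_eq_square inner_commute[of E m])
  also have "\<dots> = (norm (m - (m \<bullet> E) *\<^sub>R E))\<^sup>2"
    using norm_horizontal_sq[OF E, of m] m by simp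
  finally have nb: "norm b = norm (m - (m \<bullet> E) *\<^sub>R E)"
    by (simp add: power2_eq_iff_nonneg)
  have "a \<bullet> b = u \<bullet> E - sin r * (m \<bullet> E)"
    unfolding a_def b_def
    by (simp add: inner_diff_left inner_diff_right mm inner_commute[of u m] mu algebra_simps)
  moreover have "a \<bullet> b \<le> norm a * norm b" by (rule norm_cauchy_schwarz)
  ultimately show ?thesis by (simp add: na nb)
qed

text \<open>
  The tangent-line argument for the parabola: \<open>m\<close> is the normal of a hyperplane through the apex of
  the cone that separates the focus \<open>0\<close> from \<open>w\<close>, so \<open>w\<close> is closer to the mirror image
  \<open>-2 sin r \<bar>u\<bar> m\<close> of the focus than to the focus; \<open>d\<close> is the normal of a directrix, and that image
  lies on or beyond the directrix.
\<close>

lemma gauge_gt_if_separated: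
  fixes E m u w :: "'a::real_inner"
  assumes E: "norm E = 1" and m: "norm m = 1"
    and mu: "m \<bullet> u = sin r * norm u" and c: "cos r \<ge> 0" and s: "sin r > 0" and u0: "u \<noteq> 0"
    and sep: "m \<bullet> (u + w) < 0"
  shows "2 * (u \<bullet> E) * sin r < parabola_gauge E r w"
proof -
  define H where "H v = v - (v \<bullet> E) *\<^sub>R E" for v :: 'a
  have EE: "E \<bullet> E = 1" using E by (simp add: dot_square_norm)
  have HE: "H v \<bullet> E = 0" for v by (simp add: H_def inner_diff_left EE)
  have Hin: "H v \<bullet> v = (norm (H v))\<^sup>2" for v
    unfolding power2_norm_eq_inner
    by (subst (3) H_def) (simp add: inner_diff_right HE)
  \<comment> \<open>Since \<open>sgn 0 = 0\<close>, this covers a vertical \<open>m\<close> as well;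
    \<open>d\<close> may then be shorter than 1, and \<open>norm d \<le> 1\<close> is enough
    below.\<close>
  define d where "d = sin r *\<^sub>R E + cos r *\<^sub>R sgn (H m)"
  have sgE: "sgn (H m) \<bullet> E = 0" by (simp add: sgn_div_norm HE)
  have sg1: "norm (sgn (H m)) \<le> 1" by (simp add: norm_sgn)
  have "(norm d)\<^sup>2 = (sin r)\<^sup>2 + (cos r)\<^sup>2 * (norm (sgn (H m)))\<^sup>2"
    unfolding d_def power2_norm_eq_inner
    by (simp add: inner_add_left inner_add_right EE sgE inner_commute[of E "sgn (H m)"] power2_eq_square)
  also have "\<dots> \<le> (sin r)\<^sup>2 + (cos r)\<^sup>2 * 1"
    using sg1 by (intro add_left_mono mult_left_mono) (simp_all add: power_le_one)
  finally have "(norm d)\<^sup>2 \<le> 1\<^sup>2" by simp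
  then have nd: "norm d \<le> 1" by (rule power2_le_imp_le) simp
  have md: "m \<bullet> d = sin r * (m \<bullet> E) + cos r * norm (H m)"
  proof (cases "H m = 0")
    case False
    have "m \<bullet> sgn (H m) = norm (H m)"
      using Hin[of m] False
      by (simp add: sgn_div_norm inner_commute[of m "H m"] power2_eq_square field_simps)
    then show ?thesis by (simp add: d_def inner_add_right)
  qed (simp add: d_def inner_add_right)
  have "sgn u \<bullet> E \<le> sin r * (m \<bullet> E) + cos r * norm (H m)"
    unfolding H_def
    using u0 mu by (intro normal_height_bound E m c) (simp_all add: norm_sgn, simp add: sgn_div_norm)
  then have "(u \<bullet> E) / norm u \<le> m \<bullet> d"
    by (simp add: md sgn_div_norm divide_inverse mult.commute)
  then have uE: "u \<bullet> E \<le> norm u * (m \<bullet> d)"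
    using u0 by (simp add: divide_le_eq mult.commute)
  have wd: "w \<bullet> d \<ge> sin r * (w \<bullet> E) - cos r * norm (H w)"
  proof -
    have "w \<bullet> sgn (H m) = H w \<bullet> sgn (H m)"
      by (simp add: H_def[of w] inner_diff_left inner_commute[of E "sgn (H m)"] sgE)
    moreover have "\<bar>H w \<bullet> sgn (H m)\<bar> \<le> norm (H w) * 1"
      by (rule order_trans[OF Cauchy_Schwarz_ineq2 mult_left_mono[OF sg1 norm_ge_zero]])
    ultimately have "- norm (H w) \<le> w \<bullet> sgn (H m)" by linarith
    from mult_left_mono[OF this c] show ?thesis
      by (simp add: d_def inner_add_right)
  qed
  \<comment> \<open>The vector from the mirror image of the focus to \<open>w\<close>.\<close>
  define v where "v = w + (2 * sin r * norm u) *\<^sub>R m"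
  have mm: "m \<bullet> m = 1" using m by (simp add: dot_square_norm)
  have "(norm v)\<^sup>2 = (norm w)\<^sup>2 + 4 * sin r * norm u * (m \<bullet> (u + w))"
    unfolding v_def power2_norm_eq_inner
    by (simp add: inner_add_left inner_add_right mm mu inner_commute[of w m] algebra_simps)
  moreover have "4 * sin r * norm u * (m \<bullet> (u + w)) < 0"
    using s u0 sep by (intro mult_pos_neg) simp_all
  ultimately have "(norm v)\<^sup>2 < (norm w)\<^sup>2" by linarith
  then have "norm v < norm w" by (rule power2_less_imp_less) simp
  moreover have "v \<bullet> d \<le> norm v"
    using norm_cauchy_schwarz[of v d] mult_left_mono[OF nd norm_ge_zero[of v]] by linarith
  moreover have "v \<bullet> d = w \<bullet> d + 2 * sin r * (norm u * (m \<bullet> d))"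
    by (simp add: v_def inner_add_left)
  moreover have "2 * sin r * (u \<bullet> E) \<le> 2 * sin r * (norm u * (m \<bullet> d))"
    using s uE by simp
  ultimately have "2 * sin r * (u \<bullet> E) + (sin r * (w \<bullet> E) - cos r * norm (H w)) < norm w"
    using wd by linarith
  then show ?thesis by (simp add: parabola_gauge_def H_def[of w] algebra_simps)
qed

text \<open>The cone has apex \<open>-u\<close> and axis \<open>u\<close>, and is convex because
  \<open>r < pi / 2\<close>. If \<open>w\<close> were outside, a supporting hyperplane of the cone
  would separate \<open>w\<close> from the focus, and \<open>gauge_gt_if_separated\<close> would
  make the gauge too large.\<close>

lemma in_cone_if_gauge_le:
  fixes E u w :: "'a::real_inner"
  assumes E: "norm E = 1" and r: "0 < r" "r < pi / 2"
    and u: "u \<bullet> E > 0" and v: "(u + w) \<bullet> E > 0"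
    and G: "parabola_gauge E r w \<le> 2 * (u \<bullet> E) * sin r"
  shows "cos r * (norm u * norm (u + w)) \<le> u \<bullet> (u + w)"
proof (rule ccontr)
  assume neg: "\<not> ?thesis"
  define V where "V = u + w"
  have c: "cos r > 0" and s: "sin r > 0" using r by (simp_all add: cos_gt_zero sin_gt_zero)
  have u0: "norm u > 0" using u by auto
  define U where "U = sgn u"
  have UU: "U \<bullet> U = 1" using u0 by (simp add: U_def dot_square_norm norm_sgn)
  have uU: "u = norm u *\<^sub>R U" using u0 by (simp add: U_def sgn_div_norm)
  define \<alpha> where "\<alpha> = V \<bullet> U"
  define n where "n = V - \<alpha> *\<^sub>R U"
  define \<beta> where "\<beta> = norm n"
  have nU: "n \<bullet> U = 0" by (simp add: n_def \<alpha>_def inner_diff_left UU)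
  have V2: "(norm V)\<^sup>2 = \<alpha>\<^sup>2 + \<beta>\<^sup>2"
    using norm_horizontal_sq[of U V] u0 by (simp add: \<beta>_def n_def \<alpha>_def U_def norm_sgn)
  have "u \<bullet> V = norm u * \<alpha>" by (subst uU) (simp add: \<alpha>_def inner_commute)
  then have "norm u * \<alpha> < norm u * (cos r * norm V)"
    using neg by (simp add: V_def algebra_simps)
  then have a: "\<alpha> < cos r * norm V" using u0 by simp
  \<comment> \<open>If \<open>V\<close> were parallel to \<open>u\<close>, both being above the
    boundary would force the same direction, so the angle would be 0 and \<open>w\<close> would lie
    in the cone.\<close>
  have b: "\<beta> > 0"
  proof (rule ccontr)
    assume "\<not> \<beta> > 0"
    then have "V = \<alpha> *\<^sub>R U" by (simp add: \<beta>_def n_def)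
    moreover have "U \<bullet> E > 0" using u u0 by (simp add: U_def sgn_div_norm)
    ultimately have "\<alpha> > 0" "norm V = \<alpha>"
      using v \<open>V = \<alpha> *\<^sub>R U\<close> UU by (simp_all add: V_def[symmetric] zero_less_mult_iff norm_eq_sqrt_inner)
    then have "\<alpha> < cos r * \<alpha>" using a by simp
    moreover have "cos r * \<alpha> \<le> 1 * \<alpha>" using \<open>\<alpha> > 0\<close> by (intro mult_right_mono) simp_all
    ultimately show False by simp
  qed
  have "sin r * \<alpha> < cos r * \<beta>"
  proof (cases "\<alpha> > 0")
    case True
    have "\<alpha>\<^sup>2 < (cos r * norm V)\<^sup>2" using a True by (intro power_strict_mono) simp_all
    also have "\<dots> = (cos r)\<^sup>2 * (\<alpha>\<^sup>2 + \<beta>\<^sup>2)" by (simp add: power_mult_distrib V2)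
    finally have "(sin r * \<alpha>)\<^sup>2 < (cos r * \<beta>)\<^sup>2"
      by (simp add: power_mult_distrib sin_squared_eq algebra_simps)
    then show ?thesis by (rule power2_less_imp_less) (use c b in simp)
  next
    case False
    then have "sin r * \<alpha> \<le> 0" using s by (simp add: mult_le_0_iff)
    also have "\<dots> < cos r * \<beta>" using c b by simp
    finally show ?thesis .
  qed
  \<comment> \<open>In the plane of \<open>u\<close> and \<open>V\<close>, the unit vector
    orthogonal to the cone edge \<open>cos r *\<^sub>R U + sin r *\<^sub>R sgn n\<close> nearest to
    \<open>V\<close>, pointing to the side of the axis.\<close>
  define m where "m = sin r *\<^sub>R U - cos r *\<^sub>R sgn n"
  have n1: "sgn n \<bullet> sgn n = 1" using b by (simp add: \<beta>_def dot_square_norm norm_sgn)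
  have nU': "sgn n \<bullet> U = 0" by (simp add: sgn_div_norm nU)
  have "m \<bullet> m = (sin r)\<^sup>2 + (cos r)\<^sup>2"
    by (simp add: m_def inner_diff_left inner_diff_right UU n1 nU' inner_commute[of U "sgn n"] power2_eq_square)
  then have "norm m = 1" by (simp add: norm_eq_sqrt_inner)
  moreover have "m \<bullet> u = sin r * norm u"
    by (subst uU) (simp add: m_def inner_diff_left UU nU')
  moreover have "m \<bullet> (u + w) < 0"
  proof -
    have "V = \<alpha> *\<^sub>R U + \<beta> *\<^sub>R sgn n"
      using b by (simp add: \<beta>_def sgn_div_norm) (simp add: n_def)
    then have "m \<bullet> V = sin r * \<alpha> - cos r * \<beta>"
      by (simp add: m_def inner_diff_left inner_add_right UU n1 nU' inner_commute[of U "sgn n"])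
    then show ?thesis using \<open>sin r * \<alpha> < cos r * \<beta>\<close> by (simp add: V_def)
  qed
  ultimately have "2 * (u \<bullet> E) * sin r < parabola_gauge E r w"
    using c s u0 by (intro gauge_gt_if_separated E) auto
  then show False using G by simp
qed

text \<open>
  \<open>M\<close> is normal to the tangent at \<open>w\<close> of the parabola of the same shape through \<open>w\<close> with focus \<open>0\<close>.
  That tangent meets the base line of its own parabola in a multiple of \<open>-U\<close>, where \<open>K\<close> is \<open>M\<close>
  rotated by a right angle and \<open>U = sin r M + cos r K\<close>; the apex \<open>-u\<close> is the point of the boundary
  in that direction.
\<close>

lemma outside_cone_if_gauge_ge:
  fixes E e w :: "'a::real_inner"
  assumes E: "norm E = 1" and e: "norm e = 1" "e \<bullet> E = 0"
    and w: "w = p *\<^sub>R e + q *\<^sub>R E" and p: "p \<ge> 0"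
    and h: "h > 0" and c: "cos r \<ge> 0" and s: "sin r > 0"
    and G: "parabola_gauge E r w \<ge> 2 * h * sin r"
  obtains u where "u \<bullet> E = h" "u \<bullet> (u + w) \<le> cos r * (norm u * norm (u + w))"
proof -
  have EE: "E \<bullet> E = 1" and ee: "e \<bullet> e = 1" using E e by (simp_all add: dot_square_norm)
  have eE: "E \<bullet> e = 0" using e by (simp add: inner_commute)
  have ip: "(a *\<^sub>R e + b *\<^sub>R E) \<bullet> (a' *\<^sub>R e + b' *\<^sub>R E) = a * a' + b * b'" for a b a' b'
    by (simp add: inner_add_left inner_add_right EE ee eE e)
  define N where "N = norm w"
  have NN: "N * N = p * p + q * q"
    unfolding N_def by (simp add: w ip dot_square_norm[symmetric] flip: power2_eq_square)
  define g where "g = N + cos r * p - sin r * q"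
  have "w \<bullet> E = q" by (simp add: w inner_add_left EE e)
  then have "w - (w \<bullet> E) *\<^sub>R E = p *\<^sub>R e" by (simp add: w)
  then have gG: "parabola_gauge E r w = g"
    using p e \<open>w \<bullet> E = q\<close> by (simp add: parabola_gauge_def g_def N_def)
  have g0: "g > 0" using G h s by (simp add: gG) (smt (verit) mult_pos_pos)
  \<comment> \<open>\<open>M\<close> is \<open>-N\<close> times the gradient of
    \<open>norm w + cos r * p - sin r * q\<close> at \<open>w\<close>.\<close>
  define M1 where "M1 = - cos r * N - p"
  define M2 where "M2 = sin r * N - q"
  define U where "U = (- (sin r * p + cos r * q)) *\<^sub>R e + g *\<^sub>R E"
  \<comment> \<open>\<open>U\<close> has height \<open>g\<close>, so this scaling puts
    \<open>u\<close> at height \<open>h\<close>.\<close>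
  define u where "u = (h / g) *\<^sub>R U"
  define M where "M = M1 *\<^sub>R e + M2 *\<^sub>R E"
  define K where "K = M2 *\<^sub>R e + (- M1) *\<^sub>R E"
  have sc: "sin r * sin r + cos r * cos r = 1"
    using sin_cos_squared_add[of r] by (simp add: power2_eq_square)
  have U_eq: "U = sin r *\<^sub>R M + cos r *\<^sub>R K"
  proof -
    have "sin r * M1 + cos r * M2 = - (sin r * p + cos r * q)"
      by (simp add: M1_def M2_def algebra_simps)
    moreover have "sin r * M2 + cos r * (- M1) = g"
    proof -
      have "sin r * M2 + cos r * (- M1) = (sin r * sin r + cos r * cos r) * N + cos r * p - sin r * q"
        unfolding M1_def M2_def by algebra
      then show ?thesis by (simp only: sc g_def mult_1)
    qed
    moreover have "sin r *\<^sub>R M + cos r *\<^sub>R K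
        = (sin r * M1 + cos r * M2) *\<^sub>R e + (sin r * M2 + cos r * (- M1)) *\<^sub>R E"
      by (simp add: M_def K_def algebra_simps)
    ultimately show ?thesis by (simp add: U_def)
  qed
  have MK: "M \<bullet> K = 0" unfolding M_def K_def ip by simp
  have KK: "K \<bullet> K = M \<bullet> M" unfolding M_def K_def ip by simp
  have MM: "M \<bullet> M = 2 * N * g"
  proof -
    have "M \<bullet> M = (sin r * sin r + cos r * cos r) * (N * N) + 2 * N * (cos r * p - sin r * q)
        + (p * p + q * q)"
      unfolding M_def ip M1_def M2_def by algebra
    then show ?thesis by (simp add: sc NN[symmetric] g_def algebra_simps)
  qed
  have UM: "M \<bullet> U = sin r * (M \<bullet> M)" by (simp add: U_eq inner_add_right MK)
  have "U \<bullet> U = (sin r * sin r + cos r * cos r) * (M \<bullet> M)"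
    by (simp add: U_eq inner_add_left inner_add_right MK KK inner_commute[of K M] distrib_right mult.assoc)
  then have nU: "norm K = norm U" by (simp add: sc KK norm_eq_sqrt_inner)
  have Mw: "M \<bullet> w = - N * g"
  proof -
    have "M \<bullet> w = - N * (cos r * p - sin r * q) - (p * p + q * q)"
      unfolding M_def w ip by (simp add: M1_def M2_def algebra_simps)
    then show ?thesis by (simp add: NN[symmetric] g_def algebra_simps)
  qed
  \<comment> \<open>The gauge hypothesis enters here: it is exactly what makes the last factor
    nonpositive.\<close>
  have "M \<bullet> (u + w) = N * (2 * h * sin r - g)"
    using g0 by (simp add: u_def inner_add_right UM MM Mw field_simps)
  then have Mv: "M \<bullet> (u + w) \<le> 0"
    using G by (simp add: gG N_def mult_le_0_iff)
  \<comment> \<open>The \<open>M\<close> term is dropped by its sign; Cauchy-Schwarz for the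
    \<open>K\<close> term gives the cone bound because \<open>norm K = norm U\<close>.\<close>
  have "U \<bullet> (u + w) = sin r * (M \<bullet> (u + w)) + cos r * (K \<bullet> (u + w))"
    by (simp add: U_eq inner_add_left)
  also have "\<dots> \<le> 0 + cos r * (norm U * norm (u + w))"
    using Mv s c norm_cauchy_schwarz[of K "u + w"]
    by (intro add_mono mult_left_mono) (simp_all add: mult_le_0_iff nU)
  finally have "(h / g) * (U \<bullet> (u + w)) \<le> (h / g) * (cos r * (norm U * norm (u + w)))"
    using h g0 by (intro mult_left_mono) simp_all
  moreover have "u \<bullet> (u + w) = (h / g) * (U \<bullet> (u + w))" and "norm u = (h / g) * norm U"
    using h g0 by (subst u_def, simp)+
  ultimately have "u \<bullet> (u + w) \<le> cos r * (norm u * norm (u + w))"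
    by (simp only: mult_ac)
  moreover have "u \<bullet> E = h"
    using g0 by (simp add: u_def U_def inner_add_left EE e)
  ultimately show thesis using that by blast
qed

section \<open>Euclidean balls inside and around a sublevel set of the gauge\<close>

text \<open>Dropping the nonnegative horizontal term enlarges the region to the interior of an
  ellipsoid of revolution (for \<open>b > 0\<close>) with focus \<open>0\<close>, vertical major
  axis and eccentricity \<open>sin r\<close>. Both outer balls are obtained from this
  ellipsoid.\<close>

lemma gauge_imp_focal:
  fixes E w :: "'a::real_inner"
  assumes "cos r \<ge> 0" and "parabola_gauge E r w < b"
  shows "norm w < b + sin r * (w \<bullet> E)"
  using assms mult_nonneg_nonneg[OF assms(1) norm_ge_zero[of "w - (w \<bullet> E) *\<^sub>R E"]]
  unfolding parabola_gauge_def by linarith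

text \<open>The ball has the major axis of the ellipsoid as a diameter:
  \<open>2 * h * (tan r)\<^sup>2\<close> is the height of its centre above the focus, and the radius
  is the semi-major axis.\<close>

lemma focal_imp_ball:
  fixes E w :: "'a::real_inner"
  assumes E: "norm E = 1" and h: "h > 0" and r: "0 < r" "r < pi / 2"
    and w: "norm w < 2 * h * sin r + sin r * (w \<bullet> E)"
  shows "norm (w - (2 * h * (tan r)\<^sup>2) *\<^sub>R E) < 2 * h * (tan r / cos r)"
proof (rule power2_less_imp_less)
  have c: "cos r > 0" and s: "sin r > 0" using r by (simp_all add: cos_gt_zero sin_gt_zero)
  show "0 \<le> 2 * h * (tan r / cos r)" using c s h by (simp add: tan_def)
  have EE: "E \<bullet> E = 1" using E by (simp add: dot_square_norm)
  define q where "q = w \<bullet> E"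
  define N where "N = norm w"
  have "N\<^sup>2 < (2 * h * sin r + sin r * q)\<^sup>2"
    using w unfolding q_def N_def by (intro power_strict_mono) simp_all
  moreover have "q\<^sup>2 \<le> N\<^sup>2"
    using norm_horizontal_sq[OF E, of w] zero_le_power2[of "norm (w - (w \<bullet> E) *\<^sub>R E)"]
    unfolding q_def N_def by linarith
  \<comment> \<open>Replacing \<open>q\<^sup>2\<close> by \<open>N\<^sup>2\<close> in the squared
    focal inequality turns the ellipsoid into the sphere on its major axis.\<close>
  then have "(sin r)\<^sup>2 * q\<^sup>2 \<le> (sin r)\<^sup>2 * N\<^sup>2" by (intro mult_left_mono) simp_all
  moreover have "(cos r)\<^sup>2 * N\<^sup>2 = N\<^sup>2 - (sin r)\<^sup>2 * N\<^sup>2"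
    by (simp add: cos_squared_eq algebra_simps)
  ultimately have "(cos r)\<^sup>2 * N\<^sup>2 - 4 * h * (sin r)\<^sup>2 * q < 4 * h\<^sup>2 * (sin r)\<^sup>2"
    by (simp add: power2_eq_square algebra_simps)
  then have key: "(cos r)\<^sup>2 * ((cos r)\<^sup>2 * N\<^sup>2 - 4 * h * (sin r)\<^sup>2 * q)
      < (cos r)\<^sup>2 * (4 * h\<^sup>2 * (sin r)\<^sup>2)"
    using c by simp
  have "(norm (w - (2 * h * (tan r)\<^sup>2) *\<^sub>R E))\<^sup>2
      = N\<^sup>2 - 4 * h * (tan r)\<^sup>2 * q + 4 * h\<^sup>2 * ((tan r)\<^sup>2)\<^sup>2"
    unfolding N_def q_def power2_norm_eq_inner
    by (simp add: inner_diff_left inner_diff_right EE inner_commute[of E w] power2_eq_square algebra_simps)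
  also have "\<dots> = ((cos r)\<^sup>2 * ((cos r)\<^sup>2 * N\<^sup>2 - 4 * h * (sin r)\<^sup>2 * q)
      + 4 * h\<^sup>2 * ((sin r)\<^sup>2)\<^sup>2) / ((cos r)\<^sup>2)\<^sup>2"
    using c by (simp add: tan_def power_divide field_simps power2_eq_square)
  also have "\<dots> < ((cos r)\<^sup>2 * (4 * h\<^sup>2 * (sin r)\<^sup>2) + 4 * h\<^sup>2 * ((sin r)\<^sup>2)\<^sup>2) / ((cos r)\<^sup>2)\<^sup>2"
    using key c by (intro divide_strict_right_mono add_strict_right_mono) simp_all
  also have "\<dots> = ((sin r)\<^sup>2 + (cos r)\<^sup>2) * (4 * h\<^sup>2 * (sin r)\<^sup>2) / ((cos r)\<^sup>2)\<^sup>2"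
    by (simp only: distrib_right distrib_left power2_eq_square mult_ac add.commute)
  also have "\<dots> = (2 * h * (tan r / cos r))\<^sup>2"
    by (simp add: tan_def power_divide power_mult_distrib)
  finally show "(norm (w - (2 * h * (tan r)\<^sup>2) *\<^sub>R E))\<^sup>2 < (2 * h * (tan r / cos r))\<^sup>2" .
qed

lemma tan_over_cos_plus_tan_sq:
  assumes "cos r \<noteq> 0"
  shows "tan r / cos r + (tan r)\<^sup>2 = sin r / (1 - sin r)"
proof -
  have c2: "(cos r)\<^sup>2 = (1 - sin r) * (1 + sin r)"
    by (simp add: cos_squared_eq algebra_simps power2_eq_square)
  then have nz: "1 - sin r \<noteq> 0" "1 + sin r \<noteq> 0" using assms by auto
  have "tan r / cos r + (tan r)\<^sup>2 = sin r * (1 + sin r) / (cos r)\<^sup>2"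
    by (simp add: tan_def power_divide add_divide_distrib[symmetric] algebra_simps power2_eq_square)
  then show ?thesis using nz by (simp add: c2)
qed

text \<open>The point of the ellipsoid farthest from the focus is its top vertex, at distance
  \<open>2 * h * sin r / (1 - sin r)\<close>; this follows from
  \<open>w \<bullet> E \<le> norm w\<close>.\<close>

lemma focal_imp_centred_ball:
  fixes E w :: "'a::real_inner"
  assumes E: "norm E = 1" and r: "0 < r" "r < pi / 2"
    and w: "norm w < 2 * h * sin r + sin r * (w \<bullet> E)"
  shows "norm w < 2 * h * (tan r / cos r + (tan r)\<^sup>2)"
proof -
  have c: "cos r > 0" and s: "sin r > 0" using r by (simp_all add: cos_gt_zero sin_gt_zero)
  have s1: "sin r < 1" using sin_monotone_2pi[of r "pi/2"] r by simp
  have "sin r * (w \<bullet> E) \<le> sin r * norm w"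
    using norm_cauchy_schwarz[of w E] E s by simp
  then have "norm w * (1 - sin r) < 2 * h * sin r" using w by (simp add: algebra_simps)
  then have "norm w < 2 * h * (sin r / (1 - sin r))"
    using s1 by (simp add: field_simps)
  then show ?thesis using c by (simp add: tan_over_cos_plus_tan_sq)
qed

text \<open>The sphere touches the level set at the height of its centre, where \<open>p = R\<close>
  and \<open>q = 0\<close>. Two estimates that become equalities there suffice:
  \<open>cos r * norm w < Q\<close>, from \<open>norm u < R\<close>, and
  \<open>p < R\<close>.\<close>

lemma gauge_less_on_inner_ball:
  fixes E w :: "'a::real_inner"
  assumes E: "norm E = 1" and h: "h > 0" and r: "0 < r" "r < pi / 2"
    and w: "norm (w - (h * (tan r)\<^sup>2) *\<^sub>R E) < h * tan r"
  shows "parabola_gauge E r w < 2 * h * sin r"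
proof -
  have c: "cos r > 0" and s: "sin r > 0" using r by (simp_all add: cos_gt_zero sin_gt_zero)
  have EE: "E \<bullet> E = 1" using E by (simp add: dot_square_norm)
  define R where "R = h * tan r"
  have R: "R > 0" using h c s by (simp add: R_def tan_def)
  have hR: "h * sin r = R * cos r" using c by (simp add: R_def tan_def)
  define t where "t = R * tan r"
  have ct: "cos r * t = R * sin r" using c by (simp add: t_def tan_def)
  define u where "u = w - t *\<^sub>R E"
  have t': "h * (tan r)\<^sup>2 = t" by (simp add: t_def R_def power2_eq_square)
  have u: "norm u < R" using w by (simp add: u_def t' R_def[symmetric])
  define q where "q = u \<bullet> E"
  define p where "p = norm (u - (u \<bullet> E) *\<^sub>R E)"
  have p2: "p\<^sup>2 = (norm u)\<^sup>2 - q\<^sup>2"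
    unfolding p_def q_def by (rule norm_horizontal_sq[OF E])
  have u2: "(norm u)\<^sup>2 < R\<^sup>2" using u by (intro power_strict_mono) simp_all
  have p0: "p \<ge> 0" by (simp add: p_def)
  have "p\<^sup>2 \<le> (norm u)\<^sup>2" using p2 by simp
  then have "p \<le> norm u" by (rule power2_le_imp_le) simp
  then have pR: "p < R" using u by simp
  have "\<bar>q\<bar> \<le> norm u" using Cauchy_Schwarz_ineq2[of u E] E by (simp add: q_def)
  then have qR: "\<bar>q\<bar> < R" using u by simp
  have w_eq: "w = u + t *\<^sub>R E" by (simp add: u_def)
  have wE: "w \<bullet> E = t + q" by (simp add: w_eq inner_add_left EE q_def)
  have wH: "norm (w - (w \<bullet> E) *\<^sub>R E) = p"
    by (simp add: p_def wE) (simp add: w_eq q_def algebra_simps)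
  have sq1: "\<bar>sin r * cos r\<bar> \<le> 1"
    using mult_mono[of "\<bar>sin r\<bar>" 1 "\<bar>cos r\<bar>" 1] by (simp add: abs_mult)
  \<comment> \<open>Chosen so that \<open>Q\<^sup>2\<close> exceeds the bound on
    \<open>(cos r * norm w)\<^sup>2\<close> only by the square of
    \<open>sin r * cos r * q\<close>.\<close>
  define Q where "Q = R + sin r * cos r * q"
  have Q0: "Q \<ge> 0"
  proof -
    have "\<bar>sin r * cos r\<bar> * \<bar>q\<bar> \<le> 1 * R" using sq1 qR by (intro mult_mono) simp_all
    then show ?thesis unfolding Q_def abs_mult[symmetric] by linarith
  qed
  have "(cos r * norm w)\<^sup>2 = (cos r)\<^sup>2 * (norm u)\<^sup>2 + 2 * cos r * (cos r * t) * q + (cos r * t)\<^sup>2"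
    unfolding w_eq power_mult_distrib power2_norm_eq_inner q_def
    by (simp add: inner_add_left inner_add_right EE inner_commute[of E u] power2_eq_square algebra_simps)
  also have "\<dots> = (cos r)\<^sup>2 * (norm u)\<^sup>2 + 2 * R * (sin r * cos r * q) + R\<^sup>2 * (sin r)\<^sup>2"
    unfolding ct by (simp add: algebra_simps power2_eq_square)
  also have "\<dots> < (cos r)\<^sup>2 * R\<^sup>2 + 2 * R * (sin r * cos r * q) + R\<^sup>2 * (sin r)\<^sup>2"
    using u2 c by simp
  also have "\<dots> = R\<^sup>2 + 2 * R * (sin r * cos r * q)"
    by (simp add: cos_squared_eq algebra_simps)
  also have "\<dots> \<le> Q\<^sup>2"
    by (simp add: Q_def power2_sum)
  finally have "cos r * norm w < Q"
    by (rule power2_less_imp_less[OF _ Q0])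
  also have "Q \<le> Q + (cos r)\<^sup>2 * (R - p)" using pR by simp
  also have "\<dots> = cos r * (2 * h * sin r - cos r * p + sin r * (t + q))"
  proof -
    have "cos r * (2 * h * sin r - cos r * p + sin r * (t + q))
       = 2 * cos r * (h * sin r) - (cos r)\<^sup>2 * p + sin r * (cos r * t) + sin r * cos r * q"
      by (simp add: algebra_simps power2_eq_square)
    also have "\<dots> = 2 * (cos r)\<^sup>2 * R - (cos r)\<^sup>2 * p + (sin r)\<^sup>2 * R + sin r * cos r * q"
      unfolding ct hR by (simp add: power2_eq_square)
    also have "\<dots> = Q + (cos r)\<^sup>2 * (R - p)"
      by (simp add: Q_def sin_squared_eq algebra_simps)
    finally show ?thesis by simp
  qed
  finally have "norm w < 2 * h * sin r - cos r * p + sin r * (t + q)"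
    using c by simp
  then show ?thesis unfolding parabola_gauge_def wH by (simp add: wE)
qed

text \<open>Cauchy-Schwarz against \<open>(cos r, sin r)\<close> bounds the last two terms of the
  gauge by a second \<open>norm w\<close>. This yields the inner ball centred at
  \<open>x\<close>.\<close>

lemma gauge_le_twice_norm:
  fixes E w :: "'a::real_inner"
  assumes E: "norm E = 1"
  shows "parabola_gauge E r w \<le> 2 * norm w"
proof -
  have "cos r * norm (w - (w \<bullet> E) *\<^sub>R E) + sin r * (- (w \<bullet> E))
      \<le> sqrt ((norm (w - (w \<bullet> E) *\<^sub>R E))\<^sup>2 + (- (w \<bullet> E))\<^sup>2)"
    by (rule cos_combination_le_norm)
  also have "\<dots> = norm w" by (simp add: norm_horizontal_sq[OF E])
  finally show ?thesis by (simp add: parabola_gauge_def)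
qed

text \<open>Bounding \<open>norm w\<close> below by
  \<open>cos r * p + sin r * (w \<bullet> E)\<close> cancels the vertical term. Applied to
  \<open>e\<close> and \<open>-e\<close>, it bounds the width of a sublevel set in a horizontal
  direction.\<close>

lemma gauge_ge_horizontal:
  fixes E e w :: "'a::real_inner"
  assumes E: "norm E = 1" and e: "norm e = 1" "e \<bullet> E = 0" and c: "cos r \<ge> 0"
  shows "2 * cos r * (w \<bullet> e) \<le> parabola_gauge E r w"
proof -
  define p where "p = norm (w - (w \<bullet> E) *\<^sub>R E)"
  have "w \<bullet> e = (w - (w \<bullet> E) *\<^sub>R E) \<bullet> e"
    using e by (simp add: inner_diff_left inner_commute[of E e])
  also have "\<dots> \<le> p" using norm_cauchy_schwarz[of "w - (w \<bullet> E) *\<^sub>R E" e] e by (simp add: p_def)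
  finally have "cos r * (w \<bullet> e) \<le> cos r * p" using c by (rule mult_left_mono)
  moreover have "cos r * p + sin r * (w \<bullet> E) \<le> sqrt (p\<^sup>2 + (w \<bullet> E)\<^sup>2)"
    by (rule cos_combination_le_norm)
  then have "cos r * p + sin r * (w \<bullet> E) \<le> norm w"
    by (simp add: norm_horizontal_sq[OF E] p_def)
  ultimately show ?thesis by (simp add: parabola_gauge_def p_def[symmetric])
qed

section \<open>Visual balls of the half space and optimality\<close>

lemma last_coord_eq_inner: "last_coord x = x \<bullet> e_last"
  by (simp add: inner_axis)

lemma exists_horizontal_unit:
  assumes "CARD('n) \<ge> 2"
  obtains e :: "real ^ 'n::{finite,linorder}" where "norm e = 1" "e \<bullet> e_last = 0"
proof -
  have "UNIV \<noteq> {last_index :: 'n}"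
    using assms by (metis card_1_singleton_iff Suc_1 not_less_eq_eq One_nat_def order_refl)
  then obtain i :: 'n where "i \<noteq> last_index" by blast
  then have "norm (axis i 1 :: real ^ 'n::{finite,linorder}) = 1" "(axis i 1 :: real ^ 'n::{finite,linorder}) \<bullet> e_last = 0"
    by (simp_all add: inner_axis_axis)
  then show thesis using that by blast
qed

text \<open>Boundary points \<open>z\<close> correspond to vectors \<open>u = x - z\<close> of
  height \<open>h\<close>, so the two cone lemmas give the two inclusions. The gauge inequality also
  has to force \<open>y\<close> into the half space.\<close>

lemma visual_ball_eq_gauge:
  fixes x :: "real ^ 'n::{finite,linorder}"
  assumes n: "CARD('n) \<ge> 2" and x: "x \<in> upper_half_space" and r: "0 < r" "r < pi / 2"
  shows "visual_ball x r = {y. parabola_gauge e_last r (y - x) < 2 * last_coord x * sin r}"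
proof (intro equalityI subsetI)
  define E :: "real ^ 'n::{finite,linorder}" where "E = e_last"
  have E: "norm E = 1" and EE: "E \<bullet> E = 1" by (simp_all add: E_def inner_axis_axis)
  define h where "h = x \<bullet> E"
  have hx: "last_coord x = h" by (simp add: h_def E_def last_coord_eq_inner)
  have h: "h > 0" using x hx by (simp add: upper_half_space_def)
  have c: "cos r > 0" and s: "sin r > 0" using r by (simp_all add: cos_gt_zero sin_gt_zero)
  {
    fix y assume y: "y \<in> visual_ball x r"
    show "y \<in> {y. parabola_gauge e_last r (y - x) < 2 * last_coord x * sin r}"
    proof (rule ccontr)
      assume "\<not> ?thesis"
      then have G: "parabola_gauge E r (y - x) \<ge> 2 * h * sin r"
        by (simp add: hx E_def)
      define w where "w = y - x"
      define w' where "w' = w - (w \<bullet> E) *\<^sub>R E"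
      have w'E: "w' \<bullet> E = 0" by (simp add: w'_def inner_diff_left EE)
      obtain e0 :: "real ^ 'n::{finite,linorder}" where e0: "norm e0 = 1" "e0 \<bullet> E = 0"
        using exists_horizontal_unit[OF n] unfolding E_def by blast
      \<comment> \<open>If \<open>y\<close> lies on the vertical line through \<open>x\<close>, any
        horizontal direction will do.\<close>
      define e where "e = (if w' = 0 then e0 else sgn w')"
      have e: "norm e = 1" "e \<bullet> E = 0"
        using e0 w'E by (simp_all add: e_def norm_sgn) (simp add: sgn_div_norm)
      have "w = norm w' *\<^sub>R e + (w \<bullet> E) *\<^sub>R E"
        by (simp add: e_def sgn_div_norm) (simp add: w'_def)
      then obtain u where u: "u \<bullet> E = h" "u \<bullet> (u + w) \<le> cos r * (norm u * norm (u + w))"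
        using outside_cone_if_gauge_ge[OF E e _ norm_ge_zero h _ s] c G unfolding w_def by (metis less_imp_le)
      define z where "z = x - u"
      have z: "z \<in> half_space_boundary"
        using u(1) by (simp add: half_space_boundary_def last_coord_eq_inner E_def[symmetric])
          (simp add: z_def inner_diff_left h_def)
      have xz: "x - z = u" and yz: "y - z = u + w" by (simp_all add: z_def w_def)
      have "(x - z) \<bullet> (y - z) / (norm (x - z) * norm (y - z)) \<le> cos r"
        unfolding xz yz
      \<comment> \<open>In the degenerate case the quotient is 0 by convention, hence at most
        \<open>cos r\<close>.\<close>
      proof (cases "norm u * norm (u + w) = 0")
        case True
        then show "u \<bullet> (u + w) / (norm u * norm (u + w)) \<le> cos r" using c by (simp only: div_by_0)
      next
        case False
        then have "norm u * norm (u + w) > 0" by (simp add: less_le)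
        then show "u \<bullet> (u + w) / (norm u * norm (u + w)) \<le> cos r"
          using u(2) by (simp only: pos_divide_le_eq)
      qed
      moreover have "\<bar>(x - z) \<bullet> (y - z) / (norm (x - z) * norm (y - z))\<bar> \<le> 1"
        using Cauchy_Schwarz_ineq2[of "x - z" "y - z"] by (auto simp: abs_mult divide_le_eq_1)
      ultimately have "arccos (cos r) \<le> angle_at x z y"
        unfolding angle_at_def using cos_le_one[of r] by (intro arccos_le_arccos) linarith+
      then have "r \<le> angle_at x z y" using r by (simp add: arccos_cos)
      also have "\<dots> \<le> visual_angle_metric x y"
        unfolding visual_angle_metric_def
        by (rule cSUP_upper[OF z visual_angle_set_nonempty_bdd(2)])
      finally show False using y by (simp add: visual_ball_def)
    qed
  }
  {
    fix y assume "y \<in> {y. parabola_gauge e_last r (y - x) < 2 * last_coord x * sin r}"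
    then have G: "parabola_gauge E r (y - x) < 2 * h * sin r"
      by (simp add: hx E_def)
    define w where "w = y - x"
    have y_eq: "y = x + w" by (simp add: w_def)
    have s1: "sin r < 1" using sin_monotone_2pi[of r "pi/2"] r by simp
    have nw: "norm w < 2 * h * sin r + sin r * (w \<bullet> E)"
      using gauge_imp_focal[OF _ G] c by (simp add: w_def)
    have yE: "y \<bullet> E > 0"
    \<comment> \<open>At or below the boundary \<open>w\<close> has length at least
      \<open>h\<close>, while the focal inequality would give
      \<open>norm w < h * sin r\<close>.\<close>
    proof (rule ccontr)
      assume "\<not> y \<bullet> E > 0"
      then have a: "w \<bullet> E \<le> - h" by (simp add: y_eq inner_add_left h_def)
      then have "sin r * (w \<bullet> E) \<le> sin r * (- h)" using s by (intro mult_left_mono) simp_all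
      then have "norm w < h * sin r" using nw by (simp add: algebra_simps)
      moreover have "h * sin r < h * 1" using h s1 by (intro mult_strict_left_mono)
      moreover have "h \<le> norm w"
        using a Cauchy_Schwarz_ineq2[of w E] E by simp
      ultimately show False by simp
    qed
    then have yH: "y \<in> upper_half_space"
      by (simp add: upper_half_space_def last_coord_eq_inner E_def)
    text \<open>A strictly smaller angle still works; this makes the bound on the angles uniform in \<open>z\<close>.\<close>
    have "((\<lambda>t. 2 * h * sin t - parabola_gauge E t w) \<longlongrightarrow> 2 * h * sin r - parabola_gauge E r w) (at_left r)"
      unfolding parabola_gauge_def by (intro tendsto_intros)
    moreover have "0 < 2 * h * sin r - parabola_gauge E r w"
      unfolding w_def using G by linarith
    ultimately have "\<forall>\<^sub>F t in at_left r. 2 * h * sin t - parabola_gauge E t w > 0"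
      by (rule order_tendstoD(1))
    moreover have "\<forall>\<^sub>F t in at_left r. t \<in> {0<..<r}"
      by (rule eventually_at_left_real[OF r(1)])
    ultimately have "\<forall>\<^sub>F t in at_left r. t \<in> {0<..<r} \<and> 2 * h * sin t - parabola_gauge E t w > 0"
      by eventually_elim simp
    from eventually_happens'[OF trivial_limit_at_left_real this]
    obtain t where t: "t \<in> {0<..<r} \<and> 2 * h * sin t - parabola_gauge E t w > 0" ..
    then have Gt: "parabola_gauge E t w \<le> 2 * h * sin t" by linarith
    have t: "0 < t" "t < r" using t by simp_all
    have "angle_at x z y \<le> t" if z: "z \<in> half_space_boundary" for z
    proof -
      define u where "u = x - z"
      have zE: "z \<bullet> E = 0" using z by (simp add: half_space_boundary_def last_coord_eq_inner E_def)
      have uE: "u \<bullet> E = h" by (simp add: u_def inner_diff_left zE h_def)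
      have uw: "u + w = y - z" by (simp add: u_def w_def)
      have vE: "(u + w) \<bullet> E > 0" using yE by (simp add: uw inner_diff_left zE)
      have "cos t * (norm u * norm (u + w)) \<le> u \<bullet> (u + w)"
        using t r h vE Gt by (intro in_cone_if_gauge_le[OF E]) (simp_all add: uE)
      moreover have "norm u * norm (u + w) > 0"
        using vE uE h by (intro mult_pos_pos) auto
      ultimately have "cos t \<le> u \<bullet> (u + w) / (norm u * norm (u + w))"
        by (simp only: pos_le_divide_eq)
      moreover have "\<bar>u \<bullet> (u + w) / (norm u * norm (u + w))\<bar> \<le> 1"
        using Cauchy_Schwarz_ineq2[of u "u + w"] by (auto simp: abs_mult divide_le_eq_1)
      ultimately have "arccos (u \<bullet> (u + w) / (norm u * norm (u + w))) \<le> arccos (cos t)"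
        using cos_ge_minus_one[of t] by (intro arccos_le_arccos) linarith+
      then show ?thesis
        using t r by (simp add: angle_at_def arccos_cos u_def[symmetric] uw)
    qed
    then have "visual_angle_metric x y \<le> t"
      unfolding visual_angle_metric_def
      using visual_angle_set_nonempty_bdd(1) by (intro cSUP_least) auto
    then show "y \<in> visual_ball x r" using t yH by (simp add: visual_ball_def)
  }
qed

theorem theorem1p4:
  fixes x :: "real ^ 'n::{finite,linorder}" and r :: real
  assumes "CARD('n) \<ge> 2"
    and "x \<in> upper_half_space"
    and "0 < r" and "r < pi / 2"
  shows "ball (x + ((1 / (cos r)\<^sup>2 - 1) * last_coord x) *\<^sub>R e_last) (tan r * last_coord x)
           \<subseteq> visual_ball x r
    \<and> visual_ball x r
           \<subseteq> ball (x + (2 * last_coord x * (tan r)\<^sup>2) *\<^sub>R e_last) (2 * last_coord x * (tan r / cos r))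
    \<and> (\<forall>a \<rho>. \<rho> > tan r * last_coord x \<longrightarrow> \<not> ball a \<rho> \<subseteq> visual_ball x r)
    \<and> (\<forall>a \<rho>. \<rho> < 2 * last_coord x * (tan r / cos r) \<longrightarrow> \<not> visual_ball x r \<subseteq> ball a \<rho>)
    \<and> ball x (last_coord x * sin r) \<subseteq> visual_ball x r
    \<and> visual_ball x r \<subseteq> ball x (2 * last_coord x * (tan r / cos r + (tan r)\<^sup>2))"
proof -
  define E :: "real ^ 'n::{finite,linorder}" where "E = e_last"
  have E: "norm E = 1" and EE: "E \<bullet> E = 1" by (simp_all add: E_def inner_axis_axis)
  define h where "h = last_coord x"
  have h: "h > 0" using assms(2) by (simp add: upper_half_space_def h_def)
  note r = assms(3,4)
  have c: "cos r > 0" and s: "sin r > 0" using r by (simp_all add: cos_gt_zero sin_gt_zero)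
  have s1: "sin r < 1" using sin_monotone_2pi[of r "pi/2"] r by simp
  have VB: "y \<in> visual_ball x r \<longleftrightarrow> parabola_gauge E r (y - x) < 2 * h * sin r" for y
    by (simp add: visual_ball_eq_gauge[OF assms] E_def h_def)
  have tan2: "1 / (cos r)\<^sup>2 - 1 = (tan r)\<^sup>2"
    using tan_sec[of r] c by (simp add: inverse_eq_divide power_one_over)
  have focal: "norm (y - x) < 2 * h * sin r + sin r * ((y - x) \<bullet> E)" if "y \<in> visual_ball x r" for y
    using that c by (intro gauge_imp_focal) (simp_all add: VB)
  have "ball (x + ((1 / (cos r)\<^sup>2 - 1) * h) *\<^sub>R E) (tan r * h) \<subseteq> visual_ball x r"
  proof
    fix y assume "y \<in> ball (x + ((1 / (cos r)\<^sup>2 - 1) * h) *\<^sub>R E) (tan r * h)"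
    then have "norm (y - x - (h * (tan r)\<^sup>2) *\<^sub>R E) < h * tan r"
      by (simp add: tan2 dist_norm norm_minus_commute diff_diff_eq mult.commute)
    then show "y \<in> visual_ball x r"
      using gauge_less_on_inner_ball[OF E h r] by (simp add: VB)
  qed
  moreover have "visual_ball x r \<subseteq> ball (x + (2 * h * (tan r)\<^sup>2) *\<^sub>R E) (2 * h * (tan r / cos r))"
  proof
    fix y assume "y \<in> visual_ball x r"
    from focal_imp_ball[OF E h r focal[OF this]]
    show "y \<in> ball (x + (2 * h * (tan r)\<^sup>2) *\<^sub>R E) (2 * h * (tan r / cos r))"
      by (simp add: dist_norm norm_minus_commute diff_diff_eq)
  qed
  moreover have "\<not> ball a \<rho> \<subseteq> visual_ball x r" if \<rho>: "\<rho> > tan r * h" for a \<rho>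
  proof
    assume sub: "ball a \<rho> \<subseteq> visual_ball x r"
    obtain e :: "real ^ 'n::{finite,linorder}" where e: "norm e = 1" "e \<bullet> E = 0"
      using exists_horizontal_unit[OF assms(1)] unfolding E_def by blast
    have ee: "e \<bullet> e = 1" using e by (simp add: dot_square_norm)
    have th: "tan r * h > 0" using c s h by (simp add: tan_def)
    \<comment> \<open>A radius strictly below \<open>\<rho>\<close> keeps the antipodal points
      \<open>a + \<sigma> *\<^sub>R e\<close> and \<open>a - \<sigma> *\<^sub>R e\<close> inside the
      open ball.\<close>
    obtain \<sigma> where \<sigma>: "tan r * h < \<sigma>" "\<sigma> < \<rho>" using dense[OF \<rho>] by blast
    have "a + \<sigma> *\<^sub>R e \<in> visual_ball x r" "a - \<sigma> *\<^sub>R e \<in> visual_ball x r"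
      using sub \<sigma> th e by (auto simp: dist_norm)
    then have "parabola_gauge E r (a + \<sigma> *\<^sub>R e - x) < 2 * h * sin r"
      and "parabola_gauge E r (a - \<sigma> *\<^sub>R e - x) < 2 * h * sin r"
      by (simp_all only: VB)
    moreover have "2 * cos r * ((a + \<sigma> *\<^sub>R e - x) \<bullet> e) \<le> parabola_gauge E r (a + \<sigma> *\<^sub>R e - x)"
      using c by (intro gauge_ge_horizontal[OF E e]) simp
    moreover have "2 * cos r * ((a - \<sigma> *\<^sub>R e - x) \<bullet> (- e)) \<le> parabola_gauge E r (a - \<sigma> *\<^sub>R e - x)"
      using c e by (intro gauge_ge_horizontal[OF E]) simp_all
    ultimately have "2 * cos r * ((a + \<sigma> *\<^sub>R e - x) \<bullet> e) < 2 * h * sin r"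
      and "2 * cos r * ((a - \<sigma> *\<^sub>R e - x) \<bullet> (- e)) < 2 * h * sin r"
      by linarith+
    \<comment> \<open>Adding the two inequalities eliminates the unknown centre
      \<open>a\<close>.\<close>
    then have "cos r * \<sigma> < h * sin r"
      by (simp add: inner_add_left inner_diff_left ee algebra_simps)
    then have "\<sigma> < tan r * h" using c by (simp add: tan_def field_simps)
    then show False using \<sigma> by simp
  qed
  moreover have "\<not> visual_ball x r \<subseteq> ball a \<rho>" if \<rho>: "\<rho> < 2 * h * (tan r / cos r)" for a \<rho>
  proof
    assume sub: "visual_ball x r \<subseteq> ball a \<rho>"
    define R where "R = 2 * h * (tan r / cos r)"
    have R: "R > 0" using c s h by (simp add: R_def tan_def)
    \<comment> \<open>The ends of the vertical diameter are not in the visual ball, so they are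
      pulled towards \<open>x\<close> by a factor \<open>\<tau> < 1\<close> with
      \<open>\<rho> \<le> \<tau> * R\<close>; the maximum with 0 covers negative
      \<open>\<rho>\<close>.\<close>
    define \<tau> where "\<tau> = max 0 (\<rho> / R)"
    have \<tau>: "0 \<le> \<tau>" "\<tau> < 1" "\<rho> \<le> \<tau> * R"
      using R \<rho>[folded R_def] by (auto simp: \<tau>_def max_def field_simps mult_le_0_iff split: if_splits)
    \<comment> \<open>On the vertical axis the gauge is \<open>t * (1 - sin r)\<close> at height
      \<open>t\<close> above \<open>x\<close> and \<open>t * (1 + sin r)\<close> at depth
      \<open>t\<close> below; solving for the value \<open>2 * h * sin r\<close> gives the two ends,
      whose distance is \<open>2 * R\<close>.\<close>
    define t1 where "t1 = \<tau> * (2 * h * sin r / (1 - sin r))"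
    define t2 where "t2 = \<tau> * (2 * h * sin r / (1 + sin r))"
    have t: "0 \<le> t1" "0 \<le> t2" using \<tau> h s s1 by (simp_all add: t1_def t2_def)
    have \<tau>h: "\<tau> * (2 * h * sin r) < 1 * (2 * h * sin r)"
      using \<tau> h s by (intro mult_strict_right_mono) simp_all
    have "t1 * (1 - sin r) < 2 * h * sin r" "t2 * (1 + sin r) < 2 * h * sin r"
      using \<tau>h s s1 by (simp_all add: t1_def t2_def)
    then have "x + t1 *\<^sub>R E \<in> visual_ball x r" "x - t2 *\<^sub>R E \<in> visual_ball x r"
      using t by (simp_all add: VB parabola_gauge_def EE E algebra_simps)
    then have "dist a (x + t1 *\<^sub>R E) < \<rho>" "dist a (x - t2 *\<^sub>R E) < \<rho>"
      using sub by auto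
    then have "dist (x + t1 *\<^sub>R E) (x - t2 *\<^sub>R E) < 2 * \<rho>"
      using dist_triangle3[of "x + t1 *\<^sub>R E" "x - t2 *\<^sub>R E" a] by simp
    moreover have "dist (x + t1 *\<^sub>R E) (x - t2 *\<^sub>R E) = t1 + t2"
      using t E by (simp add: dist_norm scaleR_left_distrib[symmetric])
    moreover have "t1 + t2 = 2 * (\<tau> * R)"
    proof -
      have c2: "cos r * cos r = (1 - sin r) * (1 + sin r)"
        using cos_squared_eq[of r] by (simp add: algebra_simps power2_eq_square)
      have "R = 2 * h * sin r / (cos r * cos r)" by (simp add: R_def tan_def)
      then show ?thesis
        using s s1 unfolding t1_def t2_def c2 by (simp add: field_simps)
    qed
    ultimately show False using \<tau> by simp
  qed
  moreover have "ball x (h * sin r) \<subseteq> visual_ball x r"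
  proof
    fix y assume "y \<in> ball x (h * sin r)"
    then show "y \<in> visual_ball x r"
      using gauge_le_twice_norm[OF E, of r "y - x"] by (simp add: VB dist_norm norm_minus_commute)
  qed
  moreover have "visual_ball x r \<subseteq> ball x (2 * h * (tan r / cos r + (tan r)\<^sup>2))"
  proof
    fix y assume "y \<in> visual_ball x r"
    from focal_imp_centred_ball[OF E r focal[OF this]]
    show "y \<in> ball x (2 * h * (tan r / cos r + (tan r)\<^sup>2))"
      by (simp add: dist_norm norm_minus_commute)
  qed
  ultimately show ?thesis unfolding E_def h_def by blast
qed

end
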